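(* Let $n$ be a positive integer. Every element of $\mathfrak{sp}(n,\mathbb{C})$ is $\mathrm{Ad}_{\mathrm{Sp}(n,\mathbb{C})}$-real.
   Context: Let $\mathrm{J}_n=\begin{pmatrix}0&-\mathrm{I}_n\\ \mathrm{I}_n&0\end{pmatrix}$. Then $\mathrm{Sp}(n,\mathbb{C})=\{g\in\mathrm{SL}_{2n}(\mathbb{C}) : g^t\mathrm{J}_n g=\mathrm{J}_n\}$, with Lie algebra $\mathfrak{sp}(n,\mathbb{C})=\{z\in\mathfrak{sl}_{2n}(\mathbb{C}) : z^t\mathrm{J}_n+\mathrm{J}_n z=0\}$. For a Lie group $G$ with Lie algebra $\mathfrak{g}$, an element $X\in\mathfrak{g}$ is called $\mathrm{Ad}_G$-real if $-X=\mathrm{Ad}(g)X$ for some $g\in G$. For a linear Lie group, $\mathrm{Ad}(g)X=gXg^{-1}$. *)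

theory Defs
  imports
    Complex_Main
    "Jordan_Normal_Form.Determinant"
    "Jordan_Normal_Form.Gauss_Jordan_Elimination"
begin

definition mat_trace :: "'a :: comm_monoid_add mat \<Rightarrow> 'a" where
  "mat_trace A = (\<Sum>i < dim_row A. A $$ (i, i))"

definition SL :: "nat \<Rightarrow> complex mat set" where
  "SL m = {g \<in> carrier_mat m m. det g = 1}"

definition sl :: "nat \<Rightarrow> complex mat set" where
  "sl m = {z \<in> carrier_mat m m. mat_trace z = 0}"

definition J :: "nat \<Rightarrow> complex mat" where
  "J n = four_block_mat (0\<^sub>m n n) (- 1\<^sub>m n) (1\<^sub>m n) (0\<^sub>m n n)"

definition Sp :: "nat \<Rightarrow> complex mat set" where
  "Sp n = {g \<in> SL (2 * n). transpose_mat g * J n * g = J n}"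

definition sp :: "nat \<Rightarrow> complex mat set" where
  "sp n = {z \<in> sl (2 * n). transpose_mat z * J n + J n * z = 0\<^sub>m (2 * n) (2 * n)}"

(* mat_inverse g is Some (the two-sided inverse of g) whenever g is an invertible
   square matrix; the value of Ad is unspecified for singular g. *)
definition Ad :: "complex mat \<Rightarrow> complex mat \<Rightarrow> complex mat" where
  "Ad g X = g * X * the (mat_inverse g)"

definition Ad_real :: "complex mat set \<Rightarrow> complex mat \<Rightarrow> bool" where
  "Ad_real G X \<longleftrightarrow> (\<exists>g \<in> G. - X = Ad g X)"

end

theory Submission
  imports Defs "Jordan_Normal_Form.Jordan_Normal_Form_Existence"
begin

text \<open>
  Let \<open>X\<close> satisfy \<open>X\<^sup>T J + J X = 0\<close>. Conjugating \<open>X\<close> to \<open>-X\<close> by some invertible matrix is easy: there is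
  a symmetric invertible \<open>S\<close> with \<open>S X = X\<^sup>T S\<close> (\<open>symmetric_transpose_similarity\<close>, read off from the
  Jordan form), and then \<open>g = J S\<close> satisfies \<open>g X = J X\<^sup>T S = - X g\<close>. What remains is to correct \<open>g\<close> to an
  element of the symplectic group, and this is done by a polar decomposition.

  Call \<open>A\<^sup>* = J\<^sup>-\<^sup>1 A\<^sup>T J\<close> the adjoint for the symplectic form. Symmetry of \<open>S\<close> gives \<open>g\<^sup>* = -g\<close>, so
  \<open>V = g\<^sup>* g = - g\<^sup>2\<close> is self-adjoint and commutes with \<open>g\<close>. It commutes with \<open>X\<close> too, because \<open>g\<close>
  anticommutes with \<open>X\<close>. Over the complex numbers the invertible matrix \<open>V\<^sup>-\<^sup>1\<close> has a square root \<open>R\<close> that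
  is a polynomial in it (\<open>sqrt_mat_exists\<close>). So \<open>R\<close> is self-adjoint and commutes with \<open>g\<close> and \<open>X\<close> as well
  (\<open>poly_mat_intertwine\<close>), and \<open>k = g R\<close> satisfies \<open>k\<^sup>* k = R V R = 1\<close> and \<open>k X = - X k\<close>.

  The symmetry of \<open>S\<close> pays off once more: \<open>k\<^sup>2 = g\<^sup>2 R\<^sup>2 = -1\<close>, so that \<open>-1\<close> is not an eigenvalue of \<open>k\<close>, and
  this forces the isometry \<open>k\<close> to have determinant one (\<open>det_one_if_isometry_squares_to_minus_one\<close>).
\<close>

section \<open>Evaluating a polynomial at a matrix\<close>

definition poly_mat :: "'a :: comm_ring_1 poly \<Rightarrow> 'a mat \<Rightarrow> 'a mat" where
  "poly_mat p A = fold_coeffs (\<lambda>a M. a \<cdot>\<^sub>m 1\<^sub>m (dim_row A) + A * M) p (0\<^sub>m (dim_row A) (dim_row A))"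

lemma poly_mat_0 [simp]: "A \<in> carrier_mat n n \<Longrightarrow> poly_mat 0 A = 0\<^sub>m n n"
  by (auto simp: poly_mat_def)

lemma poly_mat_pCons:
  assumes "A \<in> carrier_mat n n"
  shows "poly_mat (pCons a p) A = a \<cdot>\<^sub>m 1\<^sub>m n + A * poly_mat p A"
proof (cases "a = 0 \<and> p = 0")
  case True
  then show ?thesis using assms by (intro eq_matI) (auto simp: poly_mat_def)
next
  case False
  then show ?thesis using assms by (auto simp: poly_mat_def)
qed

lemma poly_mat_carrier [simp]:
  assumes "A \<in> carrier_mat n n"
  shows "poly_mat p A \<in> carrier_mat n n"
  using assms by (induction p) (auto simp: poly_mat_pCons[OF assms])

lemma poly_mat_add:
  assumes A: "A \<in> carrier_mat n n"
  shows "poly_mat (p + q) A = poly_mat p A + poly_mat q A"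
proof (induction p arbitrary: q)
  case 0
  then show ?case using A by simp
next
  case (pCons a p)
  obtain b r where q: "q = pCons b r" by (cases q)
  note C = poly_mat_carrier[OF A]
  have "poly_mat (pCons a p + q) A
      = (a + b) \<cdot>\<^sub>m 1\<^sub>m n + (A * poly_mat p A + A * poly_mat r A)"
    by (simp only: q add_pCons poly_mat_pCons[OF A] pCons.IH mult_add_distrib_mat[OF A C C])
  also have "\<dots> = (a \<cdot>\<^sub>m 1\<^sub>m n + A * poly_mat p A) + (b \<cdot>\<^sub>m 1\<^sub>m n + A * poly_mat r A)"
    by (intro eq_matI)
      (use carrier_matD[OF A] carrier_matD[OF C[of p]] carrier_matD[OF C[of r]]
        in \<open>simp_all add: distrib_right del: index_mult_mat(1)\<close>)
  finally show ?case by (simp only: q poly_mat_pCons[OF A])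
qed

lemma poly_mat_smult:
  assumes A: "A \<in> carrier_mat n n"
  shows "poly_mat (smult c p) A = c \<cdot>\<^sub>m poly_mat p A"
proof (induction p)
  case 0
  then show ?case using A by auto
next
  case (pCons a p)
  note C = poly_mat_carrier[OF A]
  have "poly_mat (smult c (pCons a p)) A = (c * a) \<cdot>\<^sub>m 1\<^sub>m n + c \<cdot>\<^sub>m (A * poly_mat p A)"
    by (simp only: smult_pCons poly_mat_pCons[OF A] pCons.IH mult_smult_distrib[OF A C])
  also have "\<dots> = c \<cdot>\<^sub>m (a \<cdot>\<^sub>m 1\<^sub>m n + A * poly_mat p A)"
    by (intro eq_matI)
      (use carrier_matD[OF A] carrier_matD[OF C[of p]]
        in \<open>simp_all add: distrib_left del: index_mult_mat(1)\<close>)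
  finally show ?case by (simp only: poly_mat_pCons[OF A])
qed

lemma poly_mat_mult:
  assumes A: "A \<in> carrier_mat n n"
  shows "poly_mat (p * q) A = poly_mat p A * poly_mat q A"
proof (induction p)
  case 0
  then show ?case using A left_mult_zero_mat[OF poly_mat_carrier[OF A, of q], of n] by simp
next
  case (pCons a p)
  note C = poly_mat_carrier[OF A]
  have M: "A * poly_mat p A \<in> carrier_mat n n" by (rule mult_carrier_mat[OF A C])
  have "a \<cdot>\<^sub>m 1\<^sub>m n * poly_mat q A = a \<cdot>\<^sub>m (1\<^sub>m n * poly_mat q A)"
    by (rule mult_smult_assoc_mat[OF one_carrier_mat C])
  also have "1\<^sub>m n * poly_mat q A = poly_mat q A" by (rule left_mult_one_mat[OF C])
  finally have scal: "a \<cdot>\<^sub>m 1\<^sub>m n * poly_mat q A = a \<cdot>\<^sub>m poly_mat q A" .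
  have "poly_mat (pCons a p * q) A
      = a \<cdot>\<^sub>m poly_mat q A + (0 \<cdot>\<^sub>m 1\<^sub>m n + A * (poly_mat p A * poly_mat q A))"
    by (simp only: mult_pCons_left poly_mat_add[OF A] poly_mat_smult[OF A] poly_mat_pCons[OF A] pCons.IH)
  also have "0 \<cdot>\<^sub>m 1\<^sub>m n + A * (poly_mat p A * poly_mat q A) = A * poly_mat p A * poly_mat q A"
    unfolding assoc_mult_mat[OF A C C]
    by (intro eq_matI)
      (use carrier_matD[OF A] carrier_matD[OF C[of p]] carrier_matD[OF C[of q]]
        in \<open>simp_all del: index_mult_mat(1)\<close>)
  also have "a \<cdot>\<^sub>m poly_mat q A + A * poly_mat p A * poly_mat q A
      = (a \<cdot>\<^sub>m 1\<^sub>m n + A * poly_mat p A) * poly_mat q A"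
    unfolding scal[symmetric]
    by (rule add_mult_distrib_mat[symmetric, OF smult_carrier_mat[OF one_carrier_mat] M C])
  finally show ?case by (simp add: poly_mat_pCons[OF A])
qed

text \<open>
  With \<open>A = B\<close> this says that polynomials in a matrix commute with everything the matrix commutes
  with. The general form also lets a polynomial pass through a bilinear form, where a matrix is
  traded for its transpose, and through a change of basis.
\<close>
lemma poly_mat_intertwine:
  assumes A: "A \<in> carrier_mat n n" and B: "B \<in> carrier_mat m m" and T: "T \<in> carrier_mat n m"
    and AT: "A * T = T * B"
  shows "poly_mat p A * T = T * poly_mat p B"
proof (induction p)
  case 0
  then show ?case using A B T by auto
next
  case (pCons a p)
  note C [simp] = poly_mat_carrier[OF A] poly_mat_carrier[OF B]
  have "(a \<cdot>\<^sub>m 1\<^sub>m n + A * poly_mat p A) * T = a \<cdot>\<^sub>m 1\<^sub>m n * T + A * poly_mat p A * T"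
    using A T by (intro add_mult_distrib_mat) auto
  also have "a \<cdot>\<^sub>m 1\<^sub>m n * T = a \<cdot>\<^sub>m T"
    by (subst mult_smult_assoc_mat) (use T left_mult_one_mat in auto)
  also have "A * poly_mat p A * T = A * (poly_mat p A * T)"
    by (rule assoc_mult_mat[OF A C(1) T])
  also have "\<dots> = A * T * poly_mat p B"
    unfolding pCons.IH by (rule assoc_mult_mat[OF A T C(2), symmetric])
  also have "\<dots> = T * (B * poly_mat p B)"
    unfolding AT by (rule assoc_mult_mat[OF T B C(2)])
  also have "a \<cdot>\<^sub>m T = T * (a \<cdot>\<^sub>m 1\<^sub>m m)"
    by (subst mult_smult_distrib) (use T right_mult_one_mat in auto)
  also have "T * (a \<cdot>\<^sub>m 1\<^sub>m m) + T * (B * poly_mat p B) = T * (a \<cdot>\<^sub>m 1\<^sub>m m + B * poly_mat p B)"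
    using T B by (intro mult_add_distrib_mat[symmetric]) auto
  finally show ?case by (simp add: poly_mat_pCons[OF A] poly_mat_pCons[OF B])
qed

lemma poly_mat_transpose:
  assumes A: "A \<in> carrier_mat n n"
  shows "transpose_mat (poly_mat p A) = poly_mat p (transpose_mat A)"
proof (induction p)
  case 0
  then show ?case using A by simp
next
  case (pCons a p)
  note C [simp] = poly_mat_carrier[OF A]
  have T: "transpose_mat A \<in> carrier_mat n n" using A by simp
  have "transpose_mat (A * poly_mat p A) = poly_mat p (transpose_mat A) * transpose_mat A"
    by (simp add: transpose_mult[OF A C] pCons.IH)
  also have "\<dots> = transpose_mat A * poly_mat p (transpose_mat A)"
    by (rule poly_mat_intertwine[OF T T T]) simp
  finally have *: "transpose_mat (A * poly_mat p A) = transpose_mat A * poly_mat p (transpose_mat A)" .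
  have "transpose_mat (a \<cdot>\<^sub>m 1\<^sub>m n + A * poly_mat p A)
      = a \<cdot>\<^sub>m 1\<^sub>m n + transpose_mat (A * poly_mat p A)"
    proof -
    have "transpose_mat (a \<cdot>\<^sub>m 1\<^sub>m n) = a \<cdot>\<^sub>m 1\<^sub>m n" by (intro eq_matI) auto
    moreover have "A * poly_mat p A \<in> carrier_mat n n" using A by auto
    ultimately show ?thesis by (subst transpose_add[of _ n n]) auto
  qed
  then show ?case by (simp add: poly_mat_pCons[OF A] poly_mat_pCons[OF T] *)
qed

section \<open>Square roots of invertible complex matrices\<close>

text \<open>
  The congruence \<open>q\<^sup>2 \<equiv> x\<close> is solved one linear factor at a time. If \<open>q\<^sup>2 - x = f h\<close>, then replacing \<open>q\<close> by
  \<open>q + c f\<close> turns the cofactor \<open>h\<close> into \<open>h + 2 c q + c\<^sup>2 f\<close>, and \<open>c\<close> has to make this vanish at the new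
  root \<open>a\<close>. If \<open>f a \<noteq> 0\<close> the equation for \<open>c\<close> is quadratic, and \<open>c = (s - q a) / f a\<close> solves it for a
  square root \<open>s\<close> of \<open>a\<close>. If \<open>f a = 0\<close> it is linear, and solvable because \<open>(q a)\<^sup>2 = a \<noteq> 0\<close>.
\<close>
lemma poly_sqrt_mod_linear_factors:
  fixes as :: "complex list"
  assumes "0 \<notin> set as"
  shows "\<exists>q. (\<Prod>a\<leftarrow>as. [:- a, 1:]) dvd q * q - [:0, 1:]"
  using assms
proof (induction as)
  case Nil
  show ?case by simp
next
  case (Cons a as)
  define f where "f = (\<Prod>b\<leftarrow>as. [:- b, 1:])"
  obtain q h where q: "q * q - [:0, 1:] = f * h"
    using Cons unfolding f_def dvd_def by auto
  have at_a: "poly q a * poly q a - a = poly f a * poly h a"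
    using arg_cong[OF q, of "\<lambda>p. poly p a"] by simp
  have "\<exists>c. poly h a + 2 * c * poly q a + c * c * poly f a = 0"
  proof (cases "poly f a = 0")
    case True
    then have "poly q a \<noteq> 0" using at_a Cons.prems by auto
    then show ?thesis using True by (intro exI[of _ "- poly h a / (2 * poly q a)"]) simp
  next
    case False
    define s where "s = csqrt a"
    have s: "s * s = a" unfolding s_def by (metis power2_csqrt power2_eq_square)
    show ?thesis
    proof (intro exI)
      have "poly f a * (poly h a + 2 * ((s - poly q a) / poly f a) * poly q a
          + ((s - poly q a) / poly f a) * ((s - poly q a) / poly f a) * poly f a)
        = poly f a * poly h a + 2 * (s - poly q a) * poly q a + (s - poly q a) * (s - poly q a)"
        using False by (simp add: field_simps)
      also have "\<dots> = poly f a * poly h a + s * s - poly q a * poly q a" by (simp add: algebra_simps)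
      also have "\<dots> = 0" unfolding s at_a[symmetric] by simp
      finally show "poly h a + 2 * ((s - poly q a) / poly f a) * poly q a
          + ((s - poly q a) / poly f a) * ((s - poly q a) / poly f a) * poly f a = 0"
        using False by simp
    qed
  qed
  then obtain c where c: "poly h a + 2 * c * poly q a + c * c * poly f a = 0" by blast
  define g where "g = h + smult (2 * c) q + smult (c * c) f"
  have "poly g a = 0" using c by (simp add: g_def)
  then have "[:- a, 1:] dvd g" by (simp add: poly_eq_0_iff_dvd)
  then have "[:- a, 1:] * f dvd g * f" by (rule mult_dvd_mono) simp
  moreover have "(q + smult c f) * (q + smult c f) - [:0, 1:] = g * f"
  proof -
    have "smult c (f * q) + smult c (f * q) = smult (2 * c) (f * q)"
      by (metis mult_2 smult_add_left)
    then show ?thesis using q unfolding g_def by (simp add: algebra_simps)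
  qed
  ultimately show ?case
    by (intro exI[of _ "q + smult c f"]) (simp add: f_def[symmetric] del: mult_pCons_left)
qed

text \<open>
  The factor \<open>U - u\<^sub>k\<^sub>k\<close> sends the basis vector \<open>e\<^sub>k\<close> into the span of the earlier ones, so inductively the
  product of the first \<open>k\<close> factors annihilates \<open>e\<^sub>0, \<dots>, e\<^sub>k\<^sub>-\<^sub>1\<close>: its first \<open>k\<close> columns are zero.
\<close>
lemma cayley_hamilton_upper_triangular:
  fixes U :: "'a :: comm_ring_1 mat"
  assumes U: "U \<in> carrier_mat n n" and tri: "upper_triangular U"
  shows "poly_mat (\<Prod>a\<leftarrow>diag_mat U. [:- a, 1:]) U = 0\<^sub>m n n"
proof -
  let ?p = "\<lambda>k. \<Prod>i\<leftarrow>[0..<k]. [:- (U $$ (i, i)), 1:]"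
  note C = poly_mat_carrier[OF U]
  have "\<forall>r < n. \<forall>j < k. poly_mat (?p k) U $$ (r, j) = 0" if "k \<le> n" for k
    using that
  proof (induction k)
    case 0
    show ?case by simp
  next
    case (Suc k)
    let ?L = "poly_mat [:- (U $$ (k, k)), 1:] U"
    have L: "?L \<in> carrier_mat n n" by (rule C)
    have Lij: "?L $$ (i, j) = U $$ (i, j) - (if i = j then U $$ (k, k) else 0)"
      if "i < n" "j < n" for i j
      using U that by (simp add: poly_mat_pCons[OF U])
    have "poly_mat (?p (Suc k)) U = poly_mat (?p k) U * ?L"
      by (simp flip: poly_mat_mult[OF U])
    moreover have "(poly_mat (?p k) U * ?L) $$ (r, j) = 0" if r: "r < n" and j: "j < Suc k" for r j
    proof -
      have jn: "j < n" using j Suc.prems by simp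
      have "(poly_mat (?p k) U * ?L) $$ (r, j) = (\<Sum>l<n. poly_mat (?p k) U $$ (r, l) * ?L $$ (l, j))"
        using r jn C[of "?p k"] L by (simp add: scalar_prod_def atLeast0LessThan)
      also have "\<dots> = 0"
      proof (rule sum.neutral, rule ballI)
        fix l assume "l \<in> {..<n}"
        then have l: "l < n" by simp
        show "poly_mat (?p k) U $$ (r, l) * ?L $$ (l, j) = 0"
        proof (cases "l < k")
          case True
          then show ?thesis using Suc r by simp
        next
          case False
          then have "?L $$ (l, j) = 0"
            using Lij[OF l jn] j l U tri by (cases "l = j") (auto simp: upper_triangular_def less_Suc_eq)
          then show ?thesis by simp
        qed
      qed
      finally show ?thesis .
    qed
    ultimately show ?case by simp
  qed
  from this[of n] have "poly_mat (?p n) U = 0\<^sub>m n n"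
    using C[of "?p n"] by (intro eq_matI) auto
  then show ?thesis using U by (simp add: diag_mat_def comp_def)
qed

text \<open>
  The root is taken as a polynomial in \<open>W\<close>, not merely as some matrix with the right square, so
  that it inherits every commutation relation of \<open>W\<close>. It exists because \<open>W\<close> is a zero of a product
  of linear factors with nonzero roots, modulo which \<open>x\<close> is a square.
\<close>
lemma sqrt_mat_exists:
  fixes W :: "complex mat"
  assumes W: "W \<in> carrier_mat n n" and det: "det W \<noteq> 0"
  shows "\<exists>q. poly_mat q W * poly_mat q W = W"
proof -
  obtain es where "char_poly W = (\<Prod>a\<leftarrow>es. [:- a, 1:])"
    using char_poly_factorized[OF W] by blast
  then obtain U where U: "U \<in> carrier_mat n n" and tri: "upper_triangular U" and sim: "similar_mat W U"
    using schur_decomposition_exists[OF W] by blast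
  obtain P Q where wit: "similar_mat_wit W U P Q" using sim unfolding similar_mat_def by blast
  note P = similar_mat_witD2(6)[OF W wit] and Q = similar_mat_witD2(7)[OF W wit]
    and PQ = similar_mat_witD2(1-2)[OF W wit] and WPQ = similar_mat_witD2(3)[OF W wit]
  let ?f = "\<Prod>a\<leftarrow>diag_mat U. [:- a, 1:]"
  have "prod_list (diag_mat U) \<noteq> 0"
    using det det_similar[OF sim] det_upper_triangular[OF tri U] by simp
  then have "0 \<notin> set (diag_mat U)" by (simp add: prod_list_zero_iff)
  then obtain q h where q: "q * q - [:0, 1:] = ?f * h"
    using poly_sqrt_mod_linear_factors unfolding dvd_def by blast
  note assoc = assoc_mult_mat[of _ n n _ n _ n]
  have "W * P = P * U" using P Q U PQ by (simp add: WPQ assoc)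
  then have "poly_mat ?f W * P = P * poly_mat ?f U" by (rule poly_mat_intertwine[OF W U P])
  also have "\<dots> = 0\<^sub>m n n" using P by (simp add: cayley_hamilton_upper_triangular[OF U tri])
  finally have fP: "poly_mat ?f W * P = 0\<^sub>m n n" .
  have "poly_mat ?f W = poly_mat ?f W * (P * Q)"
    unfolding PQ by (rule right_mult_one_mat[symmetric, OF poly_mat_carrier[OF W]])
  also have "\<dots> = poly_mat ?f W * P * Q"
    by (rule assoc[symmetric, OF poly_mat_carrier[OF W] P Q])
  also have "\<dots> = 0\<^sub>m n n" unfolding fP using Q by simp
  finally have f: "poly_mat ?f W = 0\<^sub>m n n" .
  have "poly_mat q W * poly_mat q W = poly_mat (q * q) W"
    by (rule poly_mat_mult[OF W, symmetric])
  also have "q * q = [:0, 1:] + ?f * h" using q by (simp add: algebra_simps)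
  also have "poly_mat \<dots> W = poly_mat [:0, 1:] W + poly_mat ?f W * poly_mat h W"
    unfolding poly_mat_add[OF W] poly_mat_mult[OF W] ..
  also have "poly_mat [:0, 1:] W = W"
    proof -
    have "1 \<cdot>\<^sub>m 1\<^sub>m n = (1\<^sub>m n :: complex mat)" "0 \<cdot>\<^sub>m 1\<^sub>m n = (0\<^sub>m n n :: complex mat)"
      by (intro eq_matI; simp)+
    then show ?thesis using W by (simp add: poly_mat_pCons[OF W])
  qed
  also have "poly_mat ?f W * poly_mat h W = 0\<^sub>m n n"
    unfolding f by (rule left_mult_zero_mat[OF poly_mat_carrier[OF W]])
  also have "W + 0\<^sub>m n n = W" using W by simp
  finally show ?thesis by blast
qed

section \<open>Similarity of a matrix to its transpose by a symmetric matrix\<close>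

text \<open>
  The witness is the permutation matrix reversing the order of the basis: reflecting a Jordan block
  in its antidiagonal leaves it unchanged, so reversing its rows gives the same matrix as reversing
  the columns of its transpose.
\<close>
lemma jordan_block_symmetrizer:
  fixes a :: "'a :: comm_ring_1"
  shows "\<exists>F \<in> carrier_mat m m. transpose_mat F = F \<and> F * F = 1\<^sub>m m
    \<and> F * jordan_block m a = transpose_mat (jordan_block m a) * F"
proof -
  define F :: "'a mat" where "F = mat m m (\<lambda>(i, j). if j = m - Suc i then 1 else 0)"
  have F: "F \<in> carrier_mat m m" by (simp add: F_def)
  have left: "(F * M) $$ (i, j) = M $$ (m - Suc i, j)"
    if "M \<in> carrier_mat m m" "i < m" "j < m" for M i j
  proof -
    have "(F * M) $$ (i, j) = (\<Sum>l\<in>{0..<m}. (if l = m - Suc i then 1 else 0) * M $$ (l, j))"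
      using that by (simp add: F_def scalar_prod_def)
    also have "\<dots> = (\<Sum>l\<in>{0..<m}. if l = m - Suc i then M $$ (l, j) else 0)"
      by (rule sum.cong) auto
    finally show ?thesis using that by simp
  qed
  have right: "(M * F) $$ (i, j) = M $$ (i, m - Suc j)"
    if "M \<in> carrier_mat m m" "i < m" "j < m" for M i j
  proof -
    have "(M * F) $$ (i, j) = (\<Sum>l\<in>{0..<m}. M $$ (i, l) * (if j = m - Suc l then 1 else 0))"
      using that by (simp add: F_def scalar_prod_def)
    also have "\<dots> = (\<Sum>l\<in>{0..<m}. if l = m - Suc j then M $$ (i, l) else 0)"
      using that by (intro sum.cong) auto
    finally show ?thesis using that by simp
  qed
  have "transpose_mat F = F" by (rule eq_matI) (auto simp: F_def)
  moreover have "F * F = 1\<^sub>m m"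
  proof (rule eq_matI)
    fix i j assume "i < dim_row (1\<^sub>m m :: 'a mat)" "j < dim_col (1\<^sub>m m :: 'a mat)"
    then have ij: "i < m" "j < m" by auto
    have "(F * F) $$ (i, j) = F $$ (m - Suc i, j)" by (rule left[OF F ij])
    then show "(F * F) $$ (i, j) = (1\<^sub>m m :: 'a mat) $$ (i, j)" using ij by (auto simp: F_def)
  qed (use F in auto)
  moreover have "F * jordan_block m a = transpose_mat (jordan_block m a) * F"
  proof (rule eq_matI)
    have B: "jordan_block m a \<in> carrier_mat m m" by simp
    fix i j
    assume "i < dim_row (transpose_mat (jordan_block m a) * F)"
      and "j < dim_col (transpose_mat (jordan_block m a) * F)"
    then have ij: "i < m" "j < m" using F by auto
    have "(F * jordan_block m a) $$ (i, j) = jordan_block m a $$ (m - Suc i, j)"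
      by (rule left[OF B ij])
    also have "\<dots> = transpose_mat (jordan_block m a) $$ (i, m - Suc j)"
      using ij by auto
    also have "\<dots> = (transpose_mat (jordan_block m a) * F) $$ (i, j)"
      using B by (intro right[OF _ ij, symmetric]) simp
    finally show "(F * jordan_block m a) $$ (i, j) = (transpose_mat (jordan_block m a) * F) $$ (i, j)" .
  qed (use F in auto)
  ultimately show ?thesis using F by blast
qed

lemma jordan_matrix_symmetrizer:
  fixes n_as :: "(nat \<times> 'a :: comm_ring_1) list"
  defines "m \<equiv> sum_list (map fst n_as)"
  shows "\<exists>F \<in> carrier_mat m m. transpose_mat F = F \<and> F * F = 1\<^sub>m m
    \<and> F * jordan_matrix n_as = transpose_mat (jordan_matrix n_as) * F"
  unfolding m_def
proof (induction n_as)
  case Nil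
  show ?case by (intro bexI[of _ "1\<^sub>m 0"]) (auto simp: jordan_matrix_def)
next
  case (Cons x n_as)
  obtain d a where x: "x = (d, a)" by force
  define e where "e = sum_list (map fst n_as)"
  let ?B = "jordan_block d a" and ?K = "jordan_matrix n_as"
  obtain F where F: "F \<in> carrier_mat d d" "transpose_mat F = F" "F * F = 1\<^sub>m d"
    "F * ?B = transpose_mat ?B * F" using jordan_block_symmetrizer by blast
  obtain G where G: "G \<in> carrier_mat e e" "transpose_mat G = G" "G * G = 1\<^sub>m e"
    "G * ?K = transpose_mat ?K * G" using Cons unfolding e_def by blast
  have K: "?K \<in> carrier_mat e e" unfolding e_def by (rule carrier_matI) simp_all
  have B: "?B \<in> carrier_mat d d" by simp
  have dims: "dim_row (diag_block_mat (map (\<lambda>(n, a). jordan_block n a) n_as)) = e"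
    "dim_col (diag_block_mat (map (\<lambda>(n, a). jordan_block n a) n_as)) = e"
    using K by (auto simp: jordan_matrix_def)
  have eq: "jordan_matrix (x # n_as) = four_block_mat ?B (0\<^sub>m d e) (0\<^sub>m e d) ?K"
    by (simp add: x jordan_matrix_def Let_def dims)
  let ?F = "four_block_mat F (0\<^sub>m d e) (0\<^sub>m e d) G"
  have T: "transpose_mat (jordan_matrix (x # n_as))
      = four_block_mat (transpose_mat ?B) (0\<^sub>m d e) (0\<^sub>m e d) (transpose_mat ?K)"
    unfolding eq by (subst transpose_four_block_mat[OF B _ _ K]) auto
  have 1: "?F \<in> carrier_mat (d + e) (d + e)" using F G by simp
  have 2: "transpose_mat ?F = ?F"
    using F G by (subst transpose_four_block_mat[of _ d d _ e _ e]) auto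
  have 3: "?F * ?F = 1\<^sub>m (d + e)"
    using F G by (subst mult_four_block_mat[of _ d d _ e _ e _ _ d _ e]) auto
  have "?F * jordan_matrix (x # n_as) = four_block_mat (F * ?B) (0\<^sub>m d e) (0\<^sub>m e d) (G * ?K)"
    unfolding eq using F(1) G(1) B K
    by (subst mult_four_block_mat[of _ d d _ e _ e _ _ d _ e]) auto
  moreover have "transpose_mat (jordan_matrix (x # n_as)) * ?F
      = four_block_mat (transpose_mat ?B * F) (0\<^sub>m d e) (0\<^sub>m e d) (transpose_mat ?K * G)"
    unfolding T using F(1) G(1) B K
    by (subst mult_four_block_mat[of _ d d _ e _ e _ _ d _ e])
      (auto simp: right_mult_zero_mat[of _ e e] right_add_zero_mat[of _ d d])
  ultimately have 4: "?F * jordan_matrix (x # n_as) = transpose_mat (jordan_matrix (x # n_as)) * ?F"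
    by (simp add: F(4) G(4))
  show ?case using 1 2 3 4 by (intro bexI[of _ ?F]) (auto simp: x e_def)
qed

text \<open>
  If \<open>A = P K Q\<close> with \<open>Q = P\<^sup>-\<^sup>1\<close>, and the symmetric matrix \<open>F\<close> satisfies \<open>F K = K\<^sup>T F\<close>, then
  the congruent matrix \<open>Q\<^sup>T F Q\<close> is again symmetric and does the same for \<open>A\<close>. For \<open>K\<close> the Jordan normal
  form is taken.
\<close>
lemma symmetric_transpose_similarity:
  fixes A :: "complex mat"
  assumes A: "A \<in> carrier_mat n n"
  shows "\<exists>S \<in> carrier_mat n n. transpose_mat S = S \<and> det S \<noteq> 0 \<and> S * A = transpose_mat A * S"
proof -
  obtain es where "char_poly A = (\<Prod>a\<leftarrow>es. [:- a, 1:])"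
    using char_poly_factorized[OF A] by blast
  then obtain n_as where "similar_mat A (jordan_matrix n_as)"
    using jordan_nf_exists[OF A] unfolding jordan_nf_def by blast
  then obtain P Q where wit: "similar_mat_wit A (jordan_matrix n_as) P Q"
    unfolding similar_mat_def by blast
  note QP = similar_mat_witD2(2)[OF A wit] and APQ = similar_mat_witD2(3)[OF A wit]
    and K = similar_mat_witD2(5)[OF A wit] and P = similar_mat_witD2(6)[OF A wit]
    and Q = similar_mat_witD2(7)[OF A wit]
  let ?K = "jordan_matrix n_as"
  have n: "sum_list (map fst n_as) = n" using K by (metis carrier_matD(1) jordan_matrix_dim(1))
  obtain F where F: "F \<in> carrier_mat n n" and FT: "transpose_mat F = F" and FF: "F * F = 1\<^sub>m n"
    and FK: "F * ?K = transpose_mat ?K * F"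
    using jordan_matrix_symmetrizer[of n_as] unfolding n by blast
  let ?QT = "transpose_mat Q" and ?PT = "transpose_mat P" and ?KT = "transpose_mat ?K"
  have QT: "?QT \<in> carrier_mat n n" and PT: "?PT \<in> carrier_mat n n" and KT: "?KT \<in> carrier_mat n n"
    using P Q K by simp_all
  note C = mult_carrier_mat[of _ n n _ n]
  note assoc = assoc_mult_mat[of _ n n _ n _ n]
  define S where "S = ?QT * (F * Q)"
  have S: "S \<in> carrier_mat n n" unfolding S_def by (intro C QT F Q)
  have "transpose_mat S = S"
    unfolding S_def
    by (simp add: transpose_mult[OF QT C[OF F Q]] transpose_mult[OF F Q] FT assoc[OF QT F Q])
  moreover have "det S \<noteq> 0"
  proof -
    have "det F * det F = 1" using det_mult[OF F F] FF by simp
    moreover have "det Q * det P = 1" using det_mult[OF Q P] QP by simp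
    ultimately show ?thesis
      unfolding S_def det_mult[OF QT C[OF F Q]] det_mult[OF F Q] det_transpose[OF Q] by auto
  qed
  moreover have "S * A = transpose_mat A * S"
  proof -
    have "Q * A = Q * P * (?K * Q)"
      unfolding APQ assoc[OF P K Q] by (rule assoc[symmetric, OF Q P C[OF K Q]])
    also have "\<dots> = ?K * Q" unfolding QP by (rule left_mult_one_mat[OF C[OF K Q]])
    finally have QA: "Q * A = ?K * Q" .
    then have AQ: "transpose_mat A * ?QT = ?QT * ?KT"
      by (metis transpose_mult[OF Q A] transpose_mult[OF K Q])
    have "S * A = ?QT * (F * (Q * A))"
      unfolding S_def by (simp only: assoc[OF QT C[OF F Q] A] assoc[OF F Q A])
    also have "\<dots> = ?QT * (?KT * (F * Q))"
      unfolding QA by (simp only: FK assoc[OF F K Q, symmetric] assoc[OF KT F Q])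
    also have "\<dots> = transpose_mat A * ?QT * (F * Q)"
      unfolding AQ by (rule assoc[symmetric, OF QT KT C[OF F Q]])
    also have "\<dots> = transpose_mat A * S"
      unfolding S_def using A by (intro assoc QT C[OF F Q]) simp
    finally show ?thesis .
  qed
  ultimately show ?thesis using S by blast
qed

section \<open>Isometries and inverses\<close>

text \<open>
  From \<open>B = k\<^sup>T B k\<close> follows \<open>B (1 + k) = (1 + k\<^sup>T) B k\<close>. As \<open>1 + k\<close> and \<open>1 + k\<^sup>T\<close> have the same
  determinant, \<open>det k = 1\<close> as soon as \<open>-1\<close> is not an eigenvalue of \<open>k\<close>. That is guaranteed by
  \<open>k\<^sup>2 = -1\<close>, since then \<open>(1 + k) (1 - k) = 2\<close>.
\<close>
lemma det_one_if_isometry_squares_to_minus_one: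
  fixes k :: "'a :: field_char_0 mat"
  assumes k: "k \<in> carrier_mat m m" and B: "B \<in> carrier_mat m m" and detB: "det B \<noteq> 0"
    and isom: "transpose_mat k * B * k = B" and kk: "k * k = - 1\<^sub>m m"
  shows "det k = 1"
proof -
  let ?I = "1\<^sub>m m :: 'a mat" and ?kT = "transpose_mat k"
  have I: "?I \<in> carrier_mat m m" and kT: "?kT \<in> carrier_mat m m" using k by simp_all
  have "(?I + k) * (?I + - k) = (?I + - k) + (k + - (k * k))"
  proof -
    have mk: "- k \<in> carrier_mat m m" and Imk: "?I + - k \<in> carrier_mat m m" using k by simp_all
    have "(?I + k) * (?I + - k) = ?I * (?I + - k) + k * (?I + - k)"
      by (rule add_mult_distrib_mat[OF I k Imk])
    moreover have "k * (?I + - k) = k * ?I + k * - k"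
      by (rule mult_add_distrib_mat[OF k I mk])
    moreover have "?I * (?I + - k) = ?I + - k" by (rule left_mult_one_mat[OF Imk])
    ultimately show ?thesis using k by simp
  qed
  also have "\<dots> = 2 \<cdot>\<^sub>m ?I" unfolding kk by (rule eq_matI) (use k in auto)
  finally have "det (?I + k) * det (?I + - k) = 2 ^ m"
    using k det_mult[of "?I + k" m "?I + - k"] by simp
  then have nz: "det (?I + k) \<noteq> 0" by auto
  have "B * (?I + k) = B + B * k" using mult_add_distrib_mat[OF B I k] B by simp
  also have "\<dots> = B * k + ?kT * B * k"
    unfolding isom by (rule comm_add_mat) (use B k in auto)
  also have "\<dots> = B * k + ?kT * (B * k)" by (simp add: assoc_mult_mat[OF kT B k])
  also have "\<dots> = (?I + ?kT) * (B * k)"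
    using add_mult_distrib_mat[OF I kT, of "B * k" m] B k by simp
  finally have "det (B * (?I + k)) = det ((?I + ?kT) * (B * k))" by simp
  moreover have "det (?I + ?kT) = det (?I + k)"
    using det_transpose[of "?I + k" m] k transpose_add[OF I k] by simp
  ultimately have "det B * det (?I + k) = det (?I + k) * (det B * det k)"
    using k B by (simp add: det_mult[of _ m])
  then show ?thesis using nz detB by simp
qed

lemma inverse_intertwine:
  fixes A :: "'a :: semiring_1 mat"
  assumes "A \<in> carrier_mat n n" "A' \<in> carrier_mat n n" "B \<in> carrier_mat n n" "B' \<in> carrier_mat n n"
    and T: "T \<in> carrier_mat n n"
    and "A' * A = 1\<^sub>m n" "B * B' = 1\<^sub>m n" and AT: "A * T = T * B"
  shows "A' * T = T * B'"
proof -
  note assoc = assoc_mult_mat[of _ n n _ n _ n]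
  have "A' * T = A' * T * (B * B')"
    unfolding assms(7) by (rule right_mult_one_mat[symmetric, OF mult_carrier_mat[OF assms(2) T]])
  also have "\<dots> = A' * (A * T) * B'" unfolding AT using assms(1-5) by (simp add: assoc)
  also have "\<dots> = (A' * A) * (T * B')" using assms(1-5) by (simp add: assoc)
  also have "\<dots> = T * B'" using assms by simp
  finally show ?thesis .
qed

lemma inverse_mat_exists:
  fixes A :: "'a :: field mat"
  assumes A: "A \<in> carrier_mat n n" and det: "det A \<noteq> 0"
  obtains B where "mat_inverse A = Some B" "B \<in> carrier_mat n n" "A * B = 1\<^sub>m n" "B * A = 1\<^sub>m n"
proof -
  obtain B where "mat_inverse A = Some B"
    using mat_inverse(1)[OF A] det_non_zero_imp_unit[OF A det] by (metis option.exhaust)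
  with mat_inverse(2)[OF A] that show ?thesis by blast
qed

section \<open>Reality in the symplectic Lie algebra\<close>

lemma J_carrier: "J n \<in> carrier_mat (2 * n) (2 * n)"
  by (auto simp: J_def)

lemma J_square: "J n * J n = - 1\<^sub>m (2 * n)"
proof -
  have "J n * J n = four_block_mat (- 1\<^sub>m n) (0\<^sub>m n n) (0\<^sub>m n n) (- 1\<^sub>m n)"
    unfolding J_def by (subst mult_four_block_mat[of _ n n _ n _ n _ _ n _ n]) auto
  also have "\<dots> = - 1\<^sub>m (2 * n)" by (rule eq_matI) auto
  finally show ?thesis .
qed

lemma J_transpose: "transpose_mat (J n) = - J n"
  unfolding J_def by (subst transpose_four_block_mat[of _ n n _ n _ n]) (auto intro!: eq_matI)

theorem theorem4p2:
  fixes n :: nat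
  assumes "n > 0"
  shows "\<forall>X \<in> sp n. Ad_real (Sp n) X"
proof
  fix X
  assume "X \<in> sp n"
  define m where "m = 2 * n"
  define Jn where "Jn = J n"
  have X: "X \<in> carrier_mat m m" and sum: "transpose_mat X * Jn + Jn * X = 0\<^sub>m m m"
    using \<open>X \<in> sp n\<close> by (auto simp: sp_def sl_def m_def Jn_def)
  have J: "Jn \<in> carrier_mat m m" and JJ: "Jn * Jn = - 1\<^sub>m m" and JT: "transpose_mat Jn = - Jn"
    unfolding m_def Jn_def by (rule J_carrier J_square J_transpose)+
  let ?XT = "transpose_mat X"
  have XT: "?XT \<in> carrier_mat m m" using X by simp
  note C = mult_carrier_mat[of _ m m _ m]
  note assoc = assoc_mult_mat[of _ m m _ m _ m]
  have JJ': "Jn * (Jn * Y) = - Y" if Y: "Y \<in> carrier_mat m m" for Y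
    using Y by (simp add: assoc[OF J J Y, symmetric] JJ)
  have detJ: "det Jn \<noteq> 0"
  proof -
    have "det Jn * det Jn = det (- 1\<^sub>m m :: complex mat)" using det_mult[OF J J] JJ by simp
    also have "- 1\<^sub>m m = (-1) \<cdot>\<^sub>m (1\<^sub>m m :: complex mat)" by (rule eq_matI) auto
    finally show ?thesis by auto
  qed
  obtain S where S: "S \<in> carrier_mat m m" and ST: "transpose_mat S = S" and detS: "det S \<noteq> 0"
    and SX: "S * X = ?XT * S"
    using symmetric_transpose_similarity[OF X] by blast

  have XTJ: "?XT * Jn = - (Jn * X)"
  proof (rule eq_matI)
    fix i j assume "i < dim_row (- (Jn * X))" "j < dim_col (- (Jn * X))"
    then have ij: "i < m" "j < m" using J X by auto
    have "(?XT * Jn + Jn * X) $$ (i, j) = 0" using sum ij by simp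
    then show "(?XT * Jn) $$ (i, j) = (- (Jn * X)) $$ (i, j)"
      using ij J X C[OF XT J] C[OF J X] by (simp add: eq_neg_iff_add_eq_0 del: index_mult_mat(1))
  qed (use J X in auto)
  have JXT: "Jn * ?XT = - (X * Jn)"
  proof -
    have "Jn * (?XT * Jn) = X" unfolding XTJ using J X by (simp add: JJ'[OF X])
    then have "X * Jn = Jn * (?XT * (Jn * Jn))"
      using assoc[OF J C[OF XT J] J] assoc[OF XT J J] by simp
    also have "\<dots> = - (Jn * ?XT)" unfolding JJ using J XT by (simp add: right_mult_one_mat[of _ m m])
    finally show ?thesis using J XT by simp
  qed
  \<comment> \<open>\<open>g\<close> already conjugates \<open>X\<close> to \<open>-X\<close>, but it need not be symplectic.\<close>
  define g where "g = Jn * S"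
  have g: "g \<in> carrier_mat m m" unfolding g_def by (rule C[OF J S])
  have gX: "g * X = - (X * g)"
  proof -
    have "g * X = Jn * ?XT * S" unfolding g_def by (simp add: assoc[OF J S X] assoc[OF J XT S] SX)
    also have "\<dots> = - (X * g)" unfolding JXT g_def using X J S by (simp add: assoc)
    finally show ?thesis .
  qed

  let ?gT = "transpose_mat g"
  have gT: "?gT \<in> carrier_mat m m" using g by simp
  have gT_eq: "?gT = - (S * Jn)"
    unfolding g_def using S J by (simp add: transpose_mult[OF J S] ST JT)
  have gTJ: "?gT * Jn = S"
    unfolding gT_eq using S J by (simp add: assoc JJ right_mult_one_mat[of _ m m])

  \<comment> \<open>\<open>V\<close> measures the failure of \<open>g\<close> to be symplectic:
      \<open>g\<^sup>T J g = S g = J V\<close>. It commutes with \<open>X\<close> and \<open>g\<close>, and is self-adjoint for the form \<open>J\<close>.\<close>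
  define V where "V = - (g * g)"
  have V: "V \<in> carrier_mat m m" unfolding V_def using C[OF g g] by simp
  have VX: "V * X = X * V"
  proof -
    have "g * g * X = g * - (X * g)" by (simp only: assoc[OF g g X] gX)
    also have "\<dots> = - (g * X * g)" using g X by (simp add: assoc)
    also have "\<dots> = X * (g * g)" unfolding gX using g X by (simp add: assoc)
    finally show ?thesis unfolding V_def using g X by simp
  qed
  have Vg: "V * g = g * V" unfolding V_def using g by (simp add: assoc)
  have Sg: "S * g = Jn * V"
  proof -
    have "Jn * V = - (Jn * (Jn * (S * g)))" unfolding V_def using J g S by (simp add: g_def assoc)
    then show ?thesis using JJ'[OF C[OF S g]] by simp
  qed
  have VTJ: "transpose_mat V * Jn = Jn * V"
  proof -
    have "transpose_mat V * Jn = - (?gT * (?gT * Jn))"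
      unfolding V_def using gT J by (simp add: transpose_uminus transpose_mult[OF g g] assoc)
    also have "\<dots> = S * (Jn * S)" unfolding gTJ using S J by (simp add: gT_eq assoc)
    also have "\<dots> = S * g" by (simp only: g_def)
    also have "\<dots> = Jn * V" by (rule Sg)
    finally show ?thesis .
  qed
  have detV: "det V \<noteq> 0"
  proof -
    have "V = (-1) \<cdot>\<^sub>m (g * g)" unfolding V_def by (rule eq_matI) auto
    moreover have "det g \<noteq> 0" unfolding g_def det_mult[OF J S] using detJ detS by simp
    ultimately show ?thesis by (simp add: det_mult[OF g g])
  qed
  obtain W where W: "W \<in> carrier_mat m m" and VW: "V * W = 1\<^sub>m m" and WV: "W * V = 1\<^sub>m m"
    using inverse_mat_exists[OF V detV] by blast
  have detW: "det W \<noteq> 0" using det_mult[OF V W] VW by auto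
  obtain q where q: "poly_mat q W * poly_mat q W = W"
    using sqrt_mat_exists[OF W detW] by blast
  \<comment> \<open>\<open>R\<close> plays the role of \<open>V\<^sup>-\<^sup>1\<^sup>/\<^sup>2\<close>. Being a polynomial in \<open>V\<^sup>-\<^sup>1\<close>, it inherits from \<open>V\<close>
      the commutation relations and the self-adjointness.\<close>
  define R where "R = poly_mat q W"
  have R: "R \<in> carrier_mat m m" unfolding R_def by (rule poly_mat_carrier[OF W])
  have RR: "R * R = W" using q unfolding R_def .
  have RX: "R * X = X * R" unfolding R_def
    by (rule poly_mat_intertwine[OF W W X inverse_intertwine[OF V W V W X WV VW VX]])
  have Rg: "R * g = g * R" unfolding R_def
    by (rule poly_mat_intertwine[OF W W g inverse_intertwine[OF V W V W g WV VW Vg]])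
  have RV: "R * V = V * R" unfolding R_def
    by (rule poly_mat_intertwine[OF W W V]) (simp add: VW WV)
  have RTJ: "transpose_mat R * Jn = Jn * R"
  proof -
    have T: "transpose_mat V \<in> carrier_mat m m" "transpose_mat W \<in> carrier_mat m m"
      using V W by simp_all
    have WVT: "transpose_mat W * transpose_mat V = 1\<^sub>m m"
      by (metis transpose_mult[OF V W] VW transpose_one)
    show ?thesis unfolding R_def poly_mat_transpose[OF W]
      by (rule poly_mat_intertwine[OF T(2) W J inverse_intertwine[OF T V W J WVT VW VTJ]])
  qed

  define k where "k = g * R"
  have k: "k \<in> carrier_mat m m" unfolding k_def by (rule C[OF g R])
  have kk: "k * k = - 1\<^sub>m m"
  proof -
    have "k * k = g * ((R * g) * R)" unfolding k_def using g R by (simp add: assoc)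
    also have "\<dots> = (g * g) * W" unfolding Rg using g R by (simp add: assoc flip: RR)
    also have "g * g = - V" unfolding V_def by simp
    also have "- V * W = - 1\<^sub>m m" using V W by (simp add: VW)
    finally show ?thesis .
  qed
  have kX: "k * X = - (X * k)"
  proof -
    have "k * X = (g * X) * R" unfolding k_def using g R X by (simp add: assoc RX)
    also have "\<dots> = - (X * k)" unfolding gX k_def using g R X by (simp add: assoc)
    finally show ?thesis .
  qed
  have isom: "transpose_mat k * Jn * k = Jn"
  proof -
    have RT: "transpose_mat R \<in> carrier_mat m m" using R by simp
    have "transpose_mat k * Jn * k = transpose_mat R * (?gT * Jn * g) * R"
      unfolding k_def transpose_mult[OF g R] using RT gT J g R
      by (simp only: assoc[OF C[OF RT gT] J C[OF g R]] assoc[OF RT gT C[OF J C[OF g R]]]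
          assoc[OF RT C[OF C[OF gT J] g] R] assoc[OF C[OF gT J] g R] assoc[OF gT J C[OF g R]])
    also have "?gT * Jn * g = Jn * V" unfolding gTJ by (rule Sg)
    also have "transpose_mat R * (Jn * V) * R = (transpose_mat R * Jn) * (V * R)"
      by (simp only: assoc[OF RT C[OF J V] R] assoc[OF J V R] assoc[OF RT J C[OF V R]])
    also have "\<dots> = Jn * ((R * V) * R)"
      unfolding RTJ by (simp only: assoc[OF J R C[OF V R]] assoc[OF R V R])
    also have "\<dots> = Jn * (V * (R * R))" unfolding RV by (simp only: assoc[OF V R R])
    also have "\<dots> = Jn" unfolding RR VW by (rule right_mult_one_mat[OF J])
    finally show ?thesis .
  qed
  have "det k = 1"
    by (rule det_one_if_isometry_squares_to_minus_one[OF k J detJ isom kk])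
  then have "k \<in> Sp n" using k isom by (simp add: Sp_def SL_def m_def Jn_def)
  moreover have "- X = Ad k X"
  proof -
    obtain k' where k': "mat_inverse k = Some k'" "k' \<in> carrier_mat m m" "k * k' = 1\<^sub>m m"
      using inverse_mat_exists[OF k] \<open>det k = 1\<close> by auto
    have "Ad k X = - (X * k * k')" unfolding Ad_def k'(1) option.sel kX using X k k' by simp
    also have "\<dots> = - X" using X k k' by (simp add: assoc right_mult_one_mat[of _ m m])
    finally show ?thesis ..
  qed
  ultimately show "Ad_real (Sp n) X" unfolding Ad_real_def by blast
qed

end
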